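(* For $n\ge 4$, $$\sum_{k=0}^n C(n,k)\,\left|\mathcal P(n,k)\right| = \frac{n+3}{2}\,C_n-1,$$ where $C(n,k)$ is the $(n,k)$-entry of Catalan's triangle, $|\mathcal P(n,k)|$ is the number of collections in the $(n,k)$-packet, and $C_n=\frac1{n+1}\binom{2n}{n}$ is the $n$th Catalan number.
   Context: Words are finite sequences over the alphabet $I=\{1,\dots,n\}$, the vertex set of the Dynkin diagram of type $D_n$: two letters are neighbors iff they are $\{i,i+1\}$ with $1\le i\le n-2$, or $\{n-2,n\}$. Juxtaposition of words is concatenation and $[~]$ is the empty word. A word $[w_1,\dots,w_d]$ is homogeneous if whenever $w_r=w_s$ with $r<s$, there exist $t,u$ with $r<t<u<s$ such that $w_r$ is a neighbor of both $w_t$ and $w_u$. For $1\le i\le n-1$ let $s_{ij}=[i,i-1,\dots,j]$ if $i\ge j$ and $s_{ij}=[~]$ if $i<j$. Let $s_{nj}=[n,n-2,n-3,\dots,j]$ if $j\le n-2$, $s_{nj}=[n]$ if $j\in\{n-1,n\}$, and $s_{nj}=[~]$ if $j>n$. Write $s_i=s_{ii}$. A prefix is a word $s_{1i_1}s_{2i_2}\cdots s_{n-1\,i_{n-1}}$ with $1\le i_m\le m+1$ for $1\le m\le n-1$. A suffix is a word $s_{nj_1}s_{n-1\,j_2}s_{nj_3}s_{n-1\,j_4}\cdots s_{n-1+[\ell]_2\,j_\ell}$ with $\ell\ge 0$ and $1\le j_1<j_2<\cdots<j_\ell\le n-1$, where $[\ell]_2=1$ if $\ell$ is odd and $0$ if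 $\ell$ is even. Let $\mathcal W_n$ be the set of words $\boldsymbol w_0\boldsymbol w'$ with $\boldsymbol w_0$ a prefix and $\boldsymbol w'$ a suffix; these are canonical reduced words, one for each element of the Coxeter group of type $D_n$, and $\boldsymbol w'$ is called the suffix of $\boldsymbol w_0\boldsymbol w'$. For a suffix $\boldsymbol w'$, the collection $\mathbf c^n_{\boldsymbol w'}$ is the set of homogeneous words in $\mathcal W_n$ whose suffix is $\boldsymbol w'$. The $(n,k)$-packet $\mathcal P(n,k)$, $0\le k\le n$, is the following set of collections: - $\mathcal P(n,0)$: the collections labeled by suffixes $s_{n1}s_{n-1\,j_2}s_{nj_3}\cdots s_{n-1+[\ell]_2\,j_\ell}$ with $\ell\ge2$ (so $j_1=1$). - $\mathcal P(n,k)$, $1\le k\le n-3$: the collections labeled by $s_{nk}$ or by suffixes $s_{n\,k+1}s_{n-1\,j_2}s_{nj_3}\cdots s_{n-1+[\ell]_2\,j_\ell}$ with $\ell\ge 2$ (so $j_1=k+1$). - $\mathcal P(n,n-2)$: only the collection labeled by $s_{n\,n-2}=[n,n-2]$. - $\mathcal P(n,n-1)$: only the collection labeled by $s_n=[n]$. - $\mathcal P(n,n)$: only the collection labeled by the empty suffix $[~]$. Catalan's triangle: for $n\ge0$, $0\le k\le n$, $C(0,0)=1$ and, for $n\ge1$, $C(n,0)=C(n-1,0)$, $C(n,k)=C(n,k-1)+C(n-1,k)$ for $0<k<n$, and $C(n,n)=C(n,n-1)$. Equivalently $C(n,k)=\frac{(n+k)!\,(n-k+1)}{k!\,(n+1)!}$.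 *)

theory Defs
  imports Complex_Main
begin

text \<open>
  The letters are the vertices \<open>1, \<dots>, n\<close> of the Dynkin diagram of type \<open>D\<^sub>n\<close>, and words are
  lists of natural numbers.  Every word in \<open>canonical_words n\<close> below uses only the letters
  \<open>1, \<dots>, n\<close>.
\<close>

definition neighbor :: "nat \<Rightarrow> nat \<Rightarrow> nat \<Rightarrow> bool" where
  "neighbor n a b \<longleftrightarrow>
     (\<exists>i. 1 \<le> i \<and> i + 2 \<le> n \<and> {a, b} = {i, i + 1}) \<or> {a, b} = {n - 2, n}"

definition homogeneous :: "nat \<Rightarrow> nat list \<Rightarrow> bool" where
  "homogeneous n w \<longleftrightarrow>
     (\<forall>r s. r < s \<and> s < length w \<and> w ! r = w ! s \<longrightarrow>
        (\<exists>t u. r < t \<and> t < u \<and> u < s \<and>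
           neighbor n (w ! r) (w ! t) \<and> neighbor n (w ! r) (w ! u)))"

text \<open>
  \<open>seg n i j\<close> is the word \<open>s\<^sub>i\<^sub>j\<close> of type \<open>D\<^sub>n\<close>.  The descending list
  \<open>rev [j..<Suc i]\<close> is \<open>[i, i - 1, \<dots>, j]\<close>, which is empty if \<open>i < j\<close>.
\<close>

definition seg :: "nat \<Rightarrow> nat \<Rightarrow> nat \<Rightarrow> nat list" where
  "seg n i j =
     (if i < n then rev [j..<Suc i]
      else if j \<le> n - 2 then n # rev [j..<Suc (n - 2)]
      else if j \<le> n then [n]
      else [])"

definition is_prefix :: "nat \<Rightarrow> nat list \<Rightarrow> bool" where
  "is_prefix n w \<longleftrightarrow>
     (\<exists>i :: nat \<Rightarrow> nat. (\<forall>m\<in>{1..n - 1}. 1 \<le> i m \<and> i m \<le> m + 1) \<and>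
        w = concat (map (\<lambda>m. seg n m (i m)) [1..<n]))"

text \<open>
  Suffixes are indexed by lists \<open>[j\<^sub>1, \<dots>, j\<^sub>\<ell>]\<close>.  List positions start at 0, so position \<open>r\<close>
  holds \<open>j\<close> with index \<open>r + 1\<close>, and its first letter is \<open>n\<close> if \<open>r + 1\<close> is odd and \<open>n - 1\<close>
  otherwise.
\<close>

definition suffix_index :: "nat \<Rightarrow> nat list \<Rightarrow> bool" where
  "suffix_index n js \<longleftrightarrow> sorted_wrt (<) js \<and> set js \<subseteq> {1..n - 1}"

definition suffix_word :: "nat \<Rightarrow> nat list \<Rightarrow> nat list" where
  "suffix_word n js =
     concat (map (\<lambda>r. seg n (n - 1 + (r + 1) mod 2) (js ! r)) [0..<length js])"

definition is_suffix :: "nat \<Rightarrow> nat list \<Rightarrow> bool" where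
  "is_suffix n w \<longleftrightarrow> (\<exists>js. suffix_index n js \<and> w = suffix_word n js)"

definition has_suffix :: "nat \<Rightarrow> nat list \<Rightarrow> nat list \<Rightarrow> bool" where
  "has_suffix n w w' \<longleftrightarrow> is_suffix n w' \<and> (\<exists>w\<^sub>0. is_prefix n w\<^sub>0 \<and> w = w\<^sub>0 @ w')"

definition canonical_words :: "nat \<Rightarrow> nat list set" where
  "canonical_words n = {w\<^sub>0 @ w' | w\<^sub>0 w'. is_prefix n w\<^sub>0 \<and> is_suffix n w'}"

definition collection :: "nat \<Rightarrow> nat list \<Rightarrow> nat list set" where
  "collection n w' = {w \<in> canonical_words n. homogeneous n w \<and> has_suffix n w w'}"

definition packet :: "nat \<Rightarrow> nat \<Rightarrow> nat list set set" where
  "packet n k =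
     (if k = 0 then
        {collection n (suffix_word n js) | js.
           suffix_index n js \<and> 2 \<le> length js \<and> hd js = 1}
      else if k + 3 \<le> n then
        {collection n (seg n n k)} \<union>
        {collection n (suffix_word n js) | js.
           suffix_index n js \<and> 2 \<le> length js \<and> hd js = k + 1}
      else if k + 2 = n then {collection n [n, n - 2]}
      else if k + 1 = n then {collection n [n]}
      else if k = n then {collection n []}
      else {})"

text \<open>Entries outside the triangle, that is with \<open>k > n\<close>, are set to 0.\<close>

fun catalan_triangle :: "nat \<Rightarrow> nat \<Rightarrow> nat" where
  "catalan_triangle 0 k = (if k = 0 then 1 else 0)"
| "catalan_triangle (Suc n) 0 = catalan_triangle n 0"
| "catalan_triangle (Suc n) (Suc k) =
     (if Suc k < Suc n then catalan_triangle (Suc n) k + catalan_triangle n (Suc k)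
      else if Suc k = Suc n then catalan_triangle (Suc n) k
      else 0)"

definition catalan :: "nat \<Rightarrow> real" where
  "catalan n = 1 / real (n + 1) * real ((2 * n) choose n)"

end

theory Submission
  imports Defs
begin

text \<open>
  In every suffix \<open>s\<^sub>n\<^sub>j\<^sub>1 s\<^sub>n\<^sub>-\<^sub>1\<^sub>j\<^sub>2 \<dots>\<close>, two occurrences of a letter in consecutive blocks are separated
  by two of its neighbors because the \<open>j\<close>'s increase, so suffixes are themselves homogeneous and
  every collection is nonempty.  The suffix of a canonical word starts at its first letter \<open>n\<close>, so
  collections with distinct labels are disjoint, hence distinct.  The packet sizes are therefore
  numbers of labels: \<open>2\<^sup>n\<^sup>-\<^sup>2 - 1\<close> for \<open>k = 0\<close>, \<open>2\<^sup>n\<^sup>-\<^sup>2\<^sup>-\<^sup>k\<close> for \<open>1 \<le> k \<le> n - 2\<close>, and \<open>1\<close> for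
  \<open>k = n - 1, n\<close>.  The sum \<open>S\<^sub>n = \<Sum>k\<le>n. C(n,k) 2\<^sup>n\<^sup>-\<^sup>k\<close> satisfies
  \<open>S\<^sub>n\<^sub>+\<^sub>1 + C\<^sub>n\<^sub>+\<^sub>1 = 4 S\<^sub>n\<close>, which gives \<open>S\<^sub>n = (2 n + 1) C\<^sub>n\<close>.
\<close>

section \<open>Catalan's triangle\<close>

lemma catalan_triangle_eq_0: "n < k \<Longrightarrow> catalan_triangle n k = 0"
  by (induction n k rule: catalan_triangle.induct) auto

lemma catalan_triangle_0_right [simp]: "catalan_triangle n 0 = 1"
  by (induction n) auto

text \<open>Zero entries beyond the diagonal make the rule C(n,n) = C(n,n-1) an instance of the
  interior recurrence.\<close>

lemma catalan_triangle_Suc_Suc: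
  "k \<le> n \<Longrightarrow> catalan_triangle (Suc n) (Suc k) = catalan_triangle (Suc n) k + catalan_triangle n (Suc k)"
  by (simp add: catalan_triangle_eq_0)

declare catalan_triangle.simps(3) [simp del]

text \<open>Ballot-number formula C(n,k) = binom(n+k,k) - binom(n+k,k-1), stated additively to avoid
  truncated subtraction. Both sides obey Pascal's rule.\<close>

lemma catalan_triangle_binomial:
  "k \<le> n \<Longrightarrow> catalan_triangle n (Suc k) + (n + k + 1 choose k) = (n + k + 1 choose Suc k)"
proof (induction n arbitrary: k)
  case 0
  then show ?case by (simp add: catalan_triangle_eq_0)
next
  case (Suc n)
  note IH = Suc.IH
  from Suc.prems show ?case
  proof (induction k)
    case 0
    then show ?case using IH[of 0] by (simp add: catalan_triangle_Suc_Suc)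
  next
    case (Suc k)
    show ?case
    proof (cases "Suc k \<le> n")
      case True
      have "catalan_triangle (Suc n) (Suc (Suc k))
          = catalan_triangle (Suc n) (Suc k) + catalan_triangle n (Suc (Suc k))"
        using True by (rule catalan_triangle_Suc_Suc)
      moreover have "catalan_triangle (Suc n) (Suc k) + (n + k + 2 choose k) = (n + k + 2 choose Suc k)"
        using Suc.IH True by simp
      moreover have "catalan_triangle n (Suc (Suc k)) + (n + k + 2 choose Suc k)
          = (n + k + 2 choose Suc (Suc k))"
        using IH[OF True] by simp
      moreover have "Suc n + Suc k + 1 = Suc (n + k + 2)" by simp
      ultimately show ?thesis
        by (simp only: binomial_Suc_Suc)
    next
      \<comment> \<open>Just outside the triangle the entry is 0, and the two binomials agree by
        symmetry.\<close>
      case False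
      then have "k = n" using Suc.prems by simp
      moreover have "(Suc n + Suc n + 1 choose Suc n) = (Suc n + Suc n + 1 choose Suc (Suc n))"
        by (subst binomial_symmetric) simp_all
      ultimately show ?thesis
        by (simp only: catalan_triangle_eq_0[OF lessI] add_0)
    qed
  qed
qed

lemma Suc_times_central_binomial:
  "Suc n * (2 * Suc n choose Suc n) = 2 * (2 * n + 1) * (2 * n choose n)"
proof -
  have "Suc n * (2 * Suc n choose Suc n) = 2 * Suc n * (2 * n + 1 choose n)"
    using Suc_times_binomial_eq[of "2 * n + 1" n] by simp
  also have "(2 * n + 1 choose n) = (2 * n + 1 choose Suc n)"
    using binomial_symmetric[of n "2 * n + 1"] by simp
  also have "2 * Suc n * (2 * n + 1 choose Suc n) = 2 * (2 * n + 1) * (2 * n choose n)"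
    using Suc_times_binomial_eq[of "2 * n" n] by (simp add: algebra_simps)
  finally show ?thesis .
qed

lemma catalan_Suc: "real (n + 2) * catalan (Suc n) = 2 * real (2 * n + 1) * catalan n"
proof -
  have "real (Suc n) * real (2 * Suc n choose Suc n) = 2 * real (2 * n + 1) * real (2 * n choose n)"
    using Suc_times_central_binomial[of n] by (metis of_nat_mult of_nat_numeral)
  then show ?thesis
    unfolding catalan_def by (simp add: divide_simps) (simp add: algebra_simps)
qed

lemma catalan_triangle_diag: "real (catalan_triangle n n) = catalan n"
proof (cases n)
  case 0
  then show ?thesis by (simp add: catalan_def)
next
  case (Suc m)
  let ?b = "2 * Suc m choose Suc m" and ?c = "2 * Suc m choose m"
  have 1: "catalan_triangle n n + ?c = ?b"
  proof -
    have "catalan_triangle (Suc m) (Suc m) + (Suc m + m + 1 choose m) = (Suc m + m + 1 choose Suc m)"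
      by (rule catalan_triangle_binomial) simp
    moreover have "Suc m + m + 1 = 2 * Suc m" by simp
    ultimately show ?thesis by (simp only: Suc)
  qed
  \<comment> \<open>The ratio of adjacent binomials turns the difference \<open>?b - ?c\<close> into
    \<open>?b / (m + 2)\<close>.\<close>
  have 2: "(m + 2) * ?c = Suc m * ?b"
    using binomial_absorb_comp[of "2 * Suc m" m] binomial_absorption[of m "2 * Suc m"]
    by (simp del: binomial_Suc_Suc add: algebra_simps)
  have "real (m + 2) * real ?c = real (Suc m) * real ?b"
    using 2 by (metis of_nat_mult)
  moreover have "real (catalan_triangle n n) + real ?c = real ?b"
    using 1 by (metis of_nat_add)
  ultimately have "real (m + 2) * (real ?b - real (catalan_triangle n n)) = real (Suc m) * real ?b"
    by (metis add_diff_cancel_left')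
  then have "real (m + 2) * real (catalan_triangle n n) = real ?b"
    by (simp add: algebra_simps del: binomial_Suc_Suc)
  then show ?thesis
    by (simp add: catalan_def Suc field_simps del: binomial_Suc_Suc)
qed

lemma catalan_triangle_subdiag: "real (catalan_triangle (Suc n) n) = catalan (Suc n)"
  using catalan_triangle_Suc_Suc[of n n] catalan_triangle_diag[of "Suc n"]
  by (simp add: catalan_triangle_eq_0)

section \<open>Rows of Catalan's triangle weighted by powers of two\<close>

text \<open>For \<open>1 \<le> k \<le> n - 2\<close> the weight is four times the packet size;
  extending it to the whole row gives a sum with a simple recursion.\<close>

definition weighted_row :: "nat \<Rightarrow> real" where
  "weighted_row n = (\<Sum>k\<le>n. real (catalan_triangle n k) * 2 ^ (n - k))"

text \<open>Row \<open>Suc n\<close> is summed twice: splitting off the diagonal gives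
  \<open>2 * ?A + catalan (Suc n)\<close>, and the triangle recurrence gives
  \<open>?A + 2 * weighted_row n\<close>. Eliminating \<open>?A\<close> leaves the claim.\<close>

lemma weighted_row_Suc: "weighted_row (Suc n) + catalan (Suc n) = 4 * weighted_row n"
proof -
  let ?C = "\<lambda>n k. real (catalan_triangle n k)"
  let ?A = "\<Sum>k\<le>n. ?C (Suc n) k * 2 ^ (n - k)"
  have full: "weighted_row (Suc n) = 2 * ?A + catalan (Suc n)"
    unfolding weighted_row_def
    by (simp add: catalan_triangle_diag sum_distrib_left Suc_diff_le mult_ac)
  have "weighted_row (Suc n) = 2 ^ Suc n + (\<Sum>k\<le>n. ?C (Suc n) (Suc k) * 2 ^ (n - k))"
    unfolding weighted_row_def by (subst sum.atMost_Suc_shift) simp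
  also have "(\<Sum>k\<le>n. ?C (Suc n) (Suc k) * 2 ^ (n - k))
      = ?A + (\<Sum>k\<le>n. ?C n (Suc k) * 2 ^ (n - k))"
    by (simp add: catalan_triangle_Suc_Suc algebra_simps flip: sum.distrib)
  also have "2 ^ Suc n + (?A + (\<Sum>k\<le>n. ?C n (Suc k) * 2 ^ (n - k)))
      = ?A + (\<Sum>k\<le>Suc n. ?C n k * 2 ^ (Suc n - k))"
    by (subst sum.atMost_Suc_shift) simp
  also have "(\<Sum>k\<le>Suc n. ?C n k * 2 ^ (Suc n - k)) = 2 * weighted_row n"
    unfolding weighted_row_def
    by (simp add: catalan_triangle_eq_0 sum_distrib_left Suc_diff_le mult_ac)
  finally show ?thesis using full by simp
qed

lemma weighted_row_eq: "weighted_row n = real (2 * n + 1) * catalan n"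
proof (induction n)
  case 0
  then show ?case by (simp add: weighted_row_def catalan_def)
next
  case (Suc n)
  then show ?case
    using weighted_row_Suc[of n] catalan_Suc[of n] by (simp add: algebra_simps)
qed

section \<open>Homogeneity of suffixes\<close>

lemma neighbor_Suc: "1 \<le> i \<Longrightarrow> i + 2 \<le> n \<Longrightarrow> neighbor n i (Suc i) \<and> neighbor n (Suc i) i"
  unfolding neighbor_def by auto

lemma neighbor_last: "neighbor n (n - 2) n \<and> neighbor n n (n - 2)"
  unfolding neighbor_def by auto

lemma homogeneous_Nil [simp]: "homogeneous n []"
  by (simp add: homogeneous_def)

text \<open>Only pairs starting at the new letter \<open>a\<close> need checking. Two neighbors of
  \<open>a\<close> ahead of its first recurrence in \<open>w\<close> separate it from every
  recurrence.\<close>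

lemma homogeneous_Cons:
  assumes hom: "homogeneous n w"
    and gap: "a \<in> set w \<Longrightarrow> \<exists>xs c ys d zs. w = xs @ c # ys @ d # zs
      \<and> a \<notin> set (xs @ c # ys @ [d]) \<and> neighbor n a c \<and> neighbor n a d"
  shows "homogeneous n (a # w)"
  unfolding homogeneous_def
proof (intro allI impI)
  fix r s
  assume rs: "r < s \<and> s < length (a # w) \<and> (a # w) ! r = (a # w) ! s"
  then obtain s' where s': "s = Suc s'" "s' < length w" by (cases s) auto
  show "\<exists>t u. r < t \<and> t < u \<and> u < s \<and>
      neighbor n ((a # w) ! r) ((a # w) ! t) \<and> neighbor n ((a # w) ! r) ((a # w) ! u)"
  proof (cases r)
    case 0
    with rs s' have a: "w ! s' = a" by simp
    with s' have "a \<in> set w" by auto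
    then obtain xs c ys d zs where w: "w = xs @ c # ys @ d # zs"
      and notin: "a \<notin> set (xs @ c # ys @ [d])" and nb: "neighbor n a c" "neighbor n a d"
      using gap by blast
    let ?v = "xs @ c # ys @ [d]"
    have wv: "w = ?v @ zs" by (simp add: w)
    have "length ?v \<le> s'"
    proof (rule ccontr)
      assume "\<not> length ?v \<le> s'"
      then have lt: "s' < length ?v" by (simp only: not_le)
      then have "w ! s' = ?v ! s'" by (simp only: wv nth_append if_True)
      moreover have "?v ! s' \<in> set ?v" using lt by (rule nth_mem)
      ultimately have "w ! s' \<in> set ?v" by (simp only:)
      with a notin show False by (simp only:)
    qed
    moreover have "w ! length xs = c" "w ! Suc (length xs + length ys) = d"
      by (simp_all add: w nth_append)
    ultimately show ?thesis
      using 0 nb s' by (intro exI[of _ "Suc (length xs)"] exI[of _ "length xs + length ys + 2"]) auto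
  next
    case (Suc r')
    with rs s' have "r' < s' \<and> s' < length w \<and> w ! r' = w ! s'" by simp
    with hom obtain t u where "r' < t" "t < u" "u < s'"
      "neighbor n (w ! r') (w ! t)" "neighbor n (w ! r') (w ! u)"
      unfolding homogeneous_def by blast
    then show ?thesis
      using Suc s' by (intro exI[of _ "Suc t"] exI[of _ "Suc u"]) auto
  qed
qed

text \<open>
  The suffix word as a recursion; the parity of \<open>p\<close> tells whether the first block starts with
  \<open>n\<close> or with \<open>n - 1\<close>.
\<close>

fun blocks :: "nat \<Rightarrow> nat \<Rightarrow> nat list \<Rightarrow> nat list" where
  "blocks n p [] = []"
| "blocks n p (j # js) = (n - 1 + p mod 2) # rev [j..<n - 1] @ blocks n (Suc p) js"

text \<open>Both kinds of block continue with \<open>n - 2\<close> down to \<open>j\<close>, since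
  \<open>n\<close> branches off at \<open>n - 2\<close>; for \<open>j = n - 1\<close> this tail is
  empty.\<close>

lemma seg_eq:
  assumes "2 \<le> n" "1 \<le> j" "j \<le> n - 1"
  shows "seg n (n - 1 + p mod 2) j = (n - 1 + p mod 2) # rev [j..<n - 1]"
proof -
  obtain m where m: "n = Suc (Suc m)"
    using assms by (metis Suc_le_D numeral_2_eq_2 Suc_le_mono)
  have "p mod 2 = 0 \<or> p mod 2 = 1" by auto
  then show ?thesis using assms m by (auto simp: seg_def)
qed

lemma suffix_word_eq_blocks:
  assumes "2 \<le> n" "suffix_index n js"
  shows "suffix_word n js = blocks n 1 js"
proof -
  \<comment> \<open>The general offset \<open>p\<close> absorbs the index shift caused by removing
    the first block.\<close>
  have "set js \<subseteq> {1..n - 1} \<Longrightarrow>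
    concat (map (\<lambda>r. seg n (n - 1 + (r + p) mod 2) (js ! r)) [0..<length js]) = blocks n p js" for p
  proof (induction js arbitrary: p)
    case Nil
    then show ?case by simp
  next
    case (Cons j js)
    have "concat (map (\<lambda>r. seg n (n - 1 + (r + p) mod 2) ((j # js) ! r)) [0..<length (j # js)])
      = seg n (n - 1 + p mod 2) j
        @ concat (map (\<lambda>r. seg n (n - 1 + (r + Suc p) mod 2) (js ! r)) [0..<length js])"
      by (simp add: map_upt_Suc del: upt_Suc)
    then show ?case
      using Cons.IH[of "Suc p"] Cons.prems seg_eq[of n j p] assms(1) by simp
  qed
  from this[of 1] show ?thesis
    using assms(2) by (simp add: suffix_word_def suffix_index_def)
qed

lemma set_blocks_subset:
  "1 \<le> n \<Longrightarrow> \<forall>i\<in>set js. j \<le> i \<Longrightarrow> set (blocks n p js) \<subseteq> {j..<n - 1} \<union> {n - 1, n}"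
proof (induction js arbitrary: p)
  case (Cons a js)
  have "n - 1 + p mod 2 \<in> {n - 1, n}" using Cons.prems by (auto simp: mod2_eq_if)
  with Cons show ?case by fastforce
qed simp

text \<open>The word grows from right to left. A recurring letter \<open>i \<le> n - 2\<close> first
  meets \<open>i - 1\<close> in its own block, then \<open>i + 1\<close> or the head of the next
  block. A head \<open>n\<close> or \<open>n - 1\<close> recurs two blocks later at the earliest,
  after \<open>n - 2\<close> has occurred twice.\<close>

lemma homogeneous_blocks:
  assumes "3 \<le> n"
  shows "sorted_wrt (<) js \<Longrightarrow> set js \<subseteq> {1..n - 1} \<Longrightarrow> homogeneous n (blocks n p js)"
proof (induction js arbitrary: p)
  case Nil
  then show ?case by simp
next
  case (Cons j js)
  define b b' where "b = n - 1 + p mod 2" and "b' = n - 1 + Suc p mod 2"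
  have bb: "b = n \<and> b' = n - 1 \<or> b = n - 1 \<and> b' = n"
    using assms unfolding b_def b'_def by (auto simp: mod2_eq_if)
  have j: "1 \<le> j" "j \<le> n - 1" and js: "sorted_wrt (<) js" "set js \<subseteq> {1..n - 1}"
    and less: "\<forall>i\<in>set js. j < i"
    using Cons.prems by auto
  define W where "W = blocks n (Suc p) js"
  have W: "homogeneous n W" unfolding W_def using Cons.IH js .
  have inner: "j \<le> m \<Longrightarrow> m \<le> n - 1 \<Longrightarrow> homogeneous n (rev [j..<m] @ W)" for m
  proof (induction m rule: dec_induct)
    case base
    then show ?case using W by simp
  next
    case (step i)
    have "homogeneous n (i # rev [j..<i] @ W)"
    proof (rule homogeneous_Cons)
      show "homogeneous n (rev [j..<i] @ W)" using step by simp
    next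
      assume "i \<in> set (rev [j..<i] @ W)"
      then have iW: "i \<in> set W" by simp
      then obtain j2 js' where js': "js = j2 # js'" by (cases js) (auto simp: W_def)
      have Weq: "W = b' # rev [j2..<n - 1] @ blocks n (Suc (Suc p)) js'"
        by (simp add: W_def js' b'_def)
      have "set W \<subseteq> {j2..<n - 1} \<union> {n - 1, n}"
        unfolding W_def by (rule set_blocks_subset) (use js js' assms in auto)
      then have i2: "j2 \<le> i" using iW step.prems by auto
      \<comment> \<open>Strict increase enters here: \<open>j < j2 \<le> i\<close> keeps
        \<open>i - 1\<close> inside the current block.\<close>
      have "j < j2" using less js' by simp
      with i2 have ji: "j \<le> i - 1" "1 \<le> i - 1" using j by auto
      have "i = Suc (i - 1)" using ji by simp
      then have first: "rev [j..<i] = (i - 1) # rev [j..<i - 1]"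
        using upt_Suc_append[OF ji(1)] by simp
      have nb1: "neighbor n i (i - 1)"
        using neighbor_Suc[of "i - 1" n] ji step.prems by simp
      show "\<exists>xs c ys d zs. rev [j..<i] @ W = xs @ c # ys @ d # zs
        \<and> i \<notin> set (xs @ c # ys @ [d]) \<and> neighbor n i c \<and> neighbor n i d"
      proof (cases "i = n - 2")
        case True
        \<comment> \<open>The branch vertex \<open>n - 2\<close> is adjacent to both possible
          heads.\<close>
        have "neighbor n i b'"
          using bb neighbor_last[of n] neighbor_Suc[of i n] True assms
          by (auto simp: Suc_diff_Suc numeral_2_eq_2)
        moreover have "rev [j..<i] @ W = [] @ (i - 1) # rev [j..<i - 1] @ b' #
            rev [j2..<n - 1] @ blocks n (Suc (Suc p)) js'"
          by (simp add: first Weq)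
        moreover have "i \<notin> set ([] @ (i - 1) # rev [j..<i - 1] @ [b'])"
          using bb True assms by auto
        ultimately show ?thesis using nb1 by blast
      next
        case False
        with step.prems have i: "Suc i < n - 1" by auto
        \<comment> \<open>The next block descends to \<open>j2 \<le> i\<close>, so it passes
          \<open>Suc i\<close> before \<open>i\<close>.\<close>
        have "Suc i + (n - 1 - Suc i) = n - 1" using i by simp
        then have "[j2..<n - 1] = [j2..<Suc i] @ [Suc i..<n - 1]"
          using i2 upt_add_eq_append[of j2 "Suc i" "n - 1 - Suc i"] by (simp only: le_SucI)
        also have "[Suc i..<n - 1] = Suc i # [Suc (Suc i)..<n - 1]"
          using i by (rule upt_conv_Cons)
        finally have "[j2..<n - 1] = [j2..<Suc i] @ Suc i # [Suc (Suc i)..<n - 1]" .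
        then have "rev [j2..<n - 1] = rev [Suc (Suc i)..<n - 1] @ Suc i # rev [j2..<Suc i]"
          by simp
        then have "rev [j..<i] @ W = [] @ (i - 1) #
            (rev [j..<i - 1] @ b' # rev [Suc (Suc i)..<n - 1]) @ Suc i #
            rev [j2..<Suc i] @ blocks n (Suc (Suc p)) js'"
          by (simp add: first Weq del: upt_Suc)
        moreover have "i \<notin> set ([] @ (i - 1) #
            (rev [j..<i - 1] @ b' # rev [Suc (Suc i)..<n - 1]) @ [Suc i])"
          using bb i ji by auto
        moreover have "neighbor n i (Suc i)"
          using neighbor_Suc[of i n] i ji by simp
        ultimately show ?thesis using nb1 by blast
      qed
    qed
    then show ?case using step.hyps by simp
  qed
  have "homogeneous n (b # rev [j..<n - 1] @ W)"
  proof (rule homogeneous_Cons)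
    show "homogeneous n (rev [j..<n - 1] @ W)" using inner j by simp
  next
    assume "b \<in> set (rev [j..<n - 1] @ W)"
    then have bW: "b \<in> set W" using bb by auto
    then obtain j2 js' where js': "js = j2 # js'" by (cases js) (auto simp: W_def)
    have Weq: "W = b' # rev [j2..<n - 1] @ blocks n (Suc (Suc p)) js'"
      by (simp add: W_def js' b'_def)
    \<comment> \<open>The block headed by \<open>b'\<close> avoids \<open>b\<close>, so there is a
      third block; its index forces \<open>j2 \<le> n - 2\<close>, which puts \<open>n - 2\<close>
      in both earlier tails.\<close>
    with bW bb assms have "js' \<noteq> []" by auto
    then obtain j3 where "j3 \<in> set js'" by (cases js') auto
    then have j23: "j < j2" "j2 < j3" "j3 \<le> n - 1" using js js' less by auto
    have rev_upt: "rev [i..<n - 1] = (n - 2) # rev [i..<n - 2]" if "i \<le> n - 2" for i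
      using upt_Suc_append[OF that] assms by (simp add: Suc_diff_Suc numeral_2_eq_2)
    have "neighbor n b (n - 2)"
      using bb neighbor_last[of n] neighbor_Suc[of "n - 2" n] assms
      by (auto simp: Suc_diff_Suc numeral_2_eq_2)
    moreover have "rev [j..<n - 1] @ W = [] @ (n - 2) # (rev [j..<n - 2] @ [b']) @ (n - 2) #
        rev [j2..<n - 2] @ blocks n (Suc (Suc p)) js'"
      using rev_upt[of j] rev_upt[of j2] j23 by (simp add: Weq)
    moreover have "b \<notin> set ([] @ (n - 2) # (rev [j..<n - 2] @ [b']) @ [n - 2])"
      using bb assms by auto
    ultimately show "\<exists>xs c ys d zs. rev [j..<n - 1] @ W = xs @ c # ys @ d # zs
        \<and> b \<notin> set (xs @ c # ys @ [d]) \<and> neighbor n b c \<and> neighbor n b d"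
      by blast
  qed
  then show ?case by (simp add: b_def W_def)
qed

section \<open>Distinctness of collections\<close>

text \<open>Each tail is a maximal run of letters below \<open>n - 1\<close>, because the next head
  is at least \<open>n - 1\<close>; its length determines \<open>j\<close>.\<close>

lemma blocks_inject:
  "set js \<subseteq> {1..n - 1} \<Longrightarrow> set js' \<subseteq> {1..n - 1} \<Longrightarrow> blocks n p js = blocks n p js' \<Longrightarrow> js = js'"
proof (induction js arbitrary: p js')
  case Nil
  then show ?case by (cases js') auto
next
  case (Cons j js)
  then obtain i js2 where js': "js' = i # js2" by (cases js') auto
  have tw: "takeWhile (\<lambda>x. x < n - 1) (rev [k..<n - 1] @ blocks n q ks) = rev [k..<n - 1]" for k q ks
  proof -
    have "takeWhile (\<lambda>x. x < n - 1) (blocks n q ks) = []" by (cases ks) simp_all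
    then show ?thesis by (subst takeWhile_append2) simp_all
  qed
  have eq: "rev [j..<n - 1] @ blocks n (Suc p) js = rev [i..<n - 1] @ blocks n (Suc p) js2"
    using Cons.prems(3) js' by simp
  then have "rev [j..<n - 1] = rev [i..<n - 1]"
    by (metis tw)
  then have "n - 1 - j = n - 1 - i" by (metis length_rev length_upt)
  then have "j = i" using Cons.prems js' by auto
  then show ?case using Cons.IH[of js2 "Suc p"] Cons.prems js' eq by simp
qed

lemma is_prefix_Nil: "is_prefix n []"
  unfolding is_prefix_def
  \<comment> \<open>The largest permitted index, \<open>m + 1\<close>, makes every segment
    empty.\<close>
  by (intro exI[of _ Suc]) (auto simp: seg_def)

lemma is_prefix_letters: "is_prefix n w \<Longrightarrow> x \<in> set w \<Longrightarrow> x < n"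
  unfolding is_prefix_def seg_def by auto

text \<open>The empty prefix shows that no collection is empty, so distinct labels cannot coincide
  by both yielding the empty set.\<close>

lemma suffix_word_in_collection:
  assumes "3 \<le> n" "suffix_index n js"
  shows "suffix_word n js \<in> collection n (suffix_word n js)"
proof -
  have "homogeneous n (suffix_word n js)"
    using assms homogeneous_blocks[of n js 1] by (simp add: suffix_word_eq_blocks suffix_index_def)
  moreover have "is_suffix n (suffix_word n js)"
    using assms is_suffix_def by blast
  ultimately show ?thesis
    unfolding collection_def canonical_words_def has_suffix_def
    using is_prefix_Nil[of n] by (metis (mono_tags, lifting) append_Nil mem_Collect_eq)
qed

text \<open>A nonempty suffix starts with \<open>n\<close>, and prefixes avoid this letter.\<close>

lemma has_suffix_unique:
  assumes "2 \<le> n" "has_suffix n w u" "has_suffix n w v"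
  shows "u = v"
proof -
  have "dropWhile (\<lambda>x. x < n) w = u" if "has_suffix n w u" for u
  proof -
    obtain w0 js where w0: "is_prefix n w0" "w = w0 @ u"
      and js: "suffix_index n js" "u = suffix_word n js"
      using \<open>has_suffix n w u\<close> unfolding has_suffix_def is_suffix_def by blast
    have "dropWhile (\<lambda>x. x < n) u = u"
      using js suffix_word_eq_blocks[of n js] assms(1) by (cases js) auto
    then show ?thesis using w0 is_prefix_letters by simp
  qed
  with assms show ?thesis by metis
qed

lemma inj_on_collection:
  assumes "3 \<le> n"
  shows "inj_on (\<lambda>js. collection n (suffix_word n js)) {js. suffix_index n js}"
proof (rule inj_onI)
  fix js js'
  assume js: "js \<in> {js. suffix_index n js}" "js' \<in> {js. suffix_index n js}"
    and eq: "collection n (suffix_word n js) = collection n (suffix_word n js')"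
  \<comment> \<open>The first suffix lies in its own collection, hence in the equal one, and so
    carries both labels.\<close>
  have "has_suffix n (suffix_word n js) (suffix_word n js)"
    "has_suffix n (suffix_word n js) (suffix_word n js')"
    using suffix_word_in_collection[of n js] assms js eq by (auto simp: collection_def)
  then have "suffix_word n js = suffix_word n js'"
    by (rule has_suffix_unique[rotated]) (use assms in simp)
  moreover have "suffix_word n js = blocks n 1 js" "suffix_word n js' = blocks n 1 js'"
    using js assms by (simp_all add: suffix_word_eq_blocks)
  ultimately have "blocks n 1 js = blocks n 1 js'" by metis
  then show "js = js'"
    using js blocks_inject[of js n js' 1] by (simp add: suffix_index_def)
qed

section \<open>Packet sizes\<close>

definition long_indices :: "nat \<Rightarrow> nat \<Rightarrow> nat list set" where
  "long_indices n h = {js. suffix_index n js \<and> 2 \<le> length js \<and> hd js = h}"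

text \<open>A strictly increasing list is determined by its set of entries; having length at least 2
  excludes the empty set after \<open>h\<close>.\<close>

lemma long_indices_eq:
  assumes "1 \<le> h" "h \<le> n - 1"
  shows "long_indices n h = (\<lambda>A. h # sorted_list_of_set A) ` (Pow {Suc h..n - 1} - {{}})"
proof (intro equalityI subsetI)
  fix js
  assume "js \<in> long_indices n h"
  then obtain i js' where js: "js = h # i # js'" and idx: "suffix_index n js"
    unfolding long_indices_def by (cases js; cases "tl js") auto
  have "sorted_list_of_set (set (i # js')) = i # js'"
    using idx js unfolding suffix_index_def
    by (intro sorted_list_of_set.idem_if_sorted_distinct) (auto simp: strict_sorted_iff)
  moreover have "set (i # js') \<in> Pow {Suc h..n - 1} - {{}}"
    using idx js unfolding suffix_index_def by (auto simp: subset_iff Suc_le_eq)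
  ultimately show "js \<in> (\<lambda>A. h # sorted_list_of_set A) ` (Pow {Suc h..n - 1} - {{}})"
    using js by (metis image_eqI)
next
  fix js
  assume "js \<in> (\<lambda>A. h # sorted_list_of_set A) ` (Pow {Suc h..n - 1} - {{}})"
  then obtain A where A: "A \<subseteq> {Suc h..n - 1}" "A \<noteq> {}" and js: "js = h # sorted_list_of_set A"
    by auto
  have "finite A" using A finite_subset by blast
  moreover from this have "1 \<le> card A" using A by (simp add: Suc_le_eq card_gt_0_iff)
  ultimately show "js \<in> long_indices n h"
    using A assms js by (auto simp: long_indices_def suffix_index_def)
qed

lemma card_long_indices:
  assumes "1 \<le> h" "h \<le> n - 1"
  shows "card (long_indices n h) = 2 ^ (n - 1 - h) - 1" "finite (long_indices n h)"
proof -
  have inj: "inj_on (\<lambda>A. h # sorted_list_of_set A) (Pow {Suc h..n - 1} - {{}})"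
    by (rule inj_onI) (auto dest: sorted_list_of_set_inject intro: finite_subset)
  then show "card (long_indices n h) = 2 ^ (n - 1 - h) - 1"
    using assms by (simp add: long_indices_eq card_image card_Diff_subset card_Pow)
  show "finite (long_indices n h)"
    using assms by (simp add: long_indices_eq)
qed

lemma card_collections:
  assumes "3 \<le> n" "J \<subseteq> {js. suffix_index n js}"
  shows "card ((\<lambda>js. collection n (suffix_word n js)) ` J) = card J"
  using inj_on_collection[OF assms(1)] assms(2) by (metis card_image inj_on_subset)

lemma card_packet_0:
  assumes "4 \<le> n"
  shows "card (packet n 0) = 2 ^ (n - 2) - 1"
proof -
  have "packet n 0 = (\<lambda>js. collection n (suffix_word n js)) ` long_indices n 1"
    unfolding packet_def long_indices_def by auto
  moreover have "long_indices n 1 \<subseteq> {js. suffix_index n js}"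
    unfolding long_indices_def by auto
  ultimately show ?thesis
    using assms card_collections[of n "long_indices n 1"] card_long_indices[of 1 n]
    by (simp add: numeral_2_eq_2)
qed

text \<open>The one-block label \<open>[k]\<close> compensates for the excluded empty subset, which
  restores a full power of two.\<close>

lemma card_packet_middle:
  assumes "4 \<le> n" "1 \<le> k" "k \<le> n - 2"
  shows "card (packet n k) = 2 ^ (n - 2 - k)"
proof (cases "k = n - 2")
  case True
  then show ?thesis using assms by (simp add: packet_def)
next
  case False
  let ?J = "insert [k] (long_indices n (Suc k))"
  have k: "k + 3 \<le> n" using False assms by auto
  have "suffix_word n [k] = seg n n k" using assms by (simp add: suffix_word_def)
  then have "packet n k = (\<lambda>js. collection n (suffix_word n js)) ` ?J"
    using k assms unfolding packet_def long_indices_def by auto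
  moreover have "?J \<subseteq> {js. suffix_index n js}"
    using k assms unfolding long_indices_def suffix_index_def by auto
  moreover have "[k] \<notin> long_indices n (Suc k)" by (simp add: long_indices_def)
  ultimately show ?thesis
    using assms k card_collections[of n ?J] card_long_indices[of "Suc k" n]
    by (simp add: numeral_2_eq_2)
qed

lemma card_packet_last:
  assumes "4 \<le> n"
  shows "card (packet n (n - 1)) = 1" "card (packet n n) = 1"
  using assms by (auto simp: packet_def)

section \<open>Summation over all packets\<close>

theorem corollary2p14:
  fixes n :: nat
  assumes "n \<ge> 4"
  shows "(\<Sum>k = 0..n. real (catalan_triangle n k) * real (card (packet n k)))
           = (real n + 3) / 2 * catalan n - 1"
proof -
  have "n = Suc (Suc (n - 2))" using assms by simp
  then obtain m where m: "n = Suc (Suc m)" by blast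
  let ?C = "\<lambda>k. real (catalan_triangle n k)"
  let ?M = "\<Sum>k\<le>m. ?C k * 2 ^ (m - k)"
  have diag: "?C n = catalan n" "?C (Suc m) = catalan n"
    using catalan_triangle_diag[of n] catalan_triangle_subdiag[of "Suc m"] by (simp_all add: m)
  \<comment> \<open>The last two entries of the row both equal the Catalan number and have weights 2
    and 1.\<close>
  have "weighted_row n = 4 * ?M + 2 * catalan n + catalan n"
    using diag unfolding weighted_row_def m
    by (simp add: sum_distrib_left Suc_diff_le mult_ac)
  then have M: "2 * ?M = real (Suc m) * catalan n"
    by (simp add: weighted_row_eq m algebra_simps)
  \<comment> \<open>At \<open>k = 0\<close> the power of two overcounts by one, and C(n,0) =
    1.\<close>
  have "(\<Sum>k\<le>m. ?C k * real (card (packet n k)))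
      = (\<Sum>k\<le>m. ?C k * 2 ^ (m - k) - (if k = 0 then 1 else 0))"
  proof (rule sum.cong)
    fix k assume "k \<in> {..m}"
    then show "?C k * real (card (packet n k)) = ?C k * 2 ^ (m - k) - (if k = 0 then 1 else 0)"
      using card_packet_0[OF assms] card_packet_middle[OF assms, of k] m
      by (cases "k = 0") (simp_all add: of_nat_diff)
  qed simp
  also have "\<dots> = ?M - 1" by (simp add: sum_subtractf)
  finally have "(\<Sum>k = 0..n. ?C k * real (card (packet n k))) = ?M - 1 + 2 * catalan n"
    using card_packet_last[OF assms] diag by (simp add: m atLeast0AtMost)
  then show ?thesis using M by (simp add: m field_simps)
qed

end
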